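(* Let $G_S$ be a connected self-loop graph of order $n \geq 2$ and size $m \geq 1$, with $|S|=\sigma$, such that its complement $\overline{G_S}$ (of size $\overline{m}$) is also connected. Let $\lambda_1$ and $\overline{\lambda}_1$ be the spectral radius (largest eigenvalue) of $G_S$ and $\overline{G_S}$, respectively. Then $$n-1+ \frac{2\sigma}{n} \leq \lambda_1+\overline{\lambda}_1 \leq \frac{2\sigma}{n} + \sqrt{2}\, \sqrt{\frac{2\sigma(n-1)(n-\sigma)}{n^2} + (n-1)^2}.$$
   Context: For a finite simple graph $G$ and $S\subseteq V(G)$, the self-loop graph $G_S$ is obtained from $G$ by attaching one loop at each vertex of $S$; its adjacency matrix is $A(G_S)=A(G)+\mathfrak{I}_S$, where $\mathfrak{I}_S$ is the diagonal $0/1$ matrix with ones exactly at the positions corresponding to $S$. The size of $G_S$ is the number of edges of $G$ (loops are not counted). The complement of $G_S$ is defined as $\overline{G_S}:=\overline{G}_S$, i.e. the graph obtained from the usual complement $\overline{G}$ by attaching loops at the vertices of the same set $S$. Eigenvalues are those of the adjacency matrix. *)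

theory Defs
  imports "Graph_Theory.Graph_Theory" "Jordan_Normal_Form.Spectral_Radius"
begin

text \<open>A finite simple graph is a \<open>pair_graph\<close>: a finite, loop-free, symmetric set of arcs,
  each undirected edge being represented by its two orientations.\<close>

definition graph_size :: "'a pair_pre_digraph \<Rightarrow> nat" where
  "graph_size G = card {{u, v} | u v. (u, v) \<in> parcs G}"

definition graph_complement :: "'a pair_pre_digraph \<Rightarrow> 'a pair_pre_digraph" where
  "graph_complement G = \<lparr> pverts = pverts G,
     parcs = {(u, v). u \<in> pverts G \<and> v \<in> pverts G \<and> u \<noteq> v \<and> (u, v) \<notin> parcs G} \<rparr>"

text \<open>The self-loop graph \<open>G\<^sub>S\<close>; its complement is \<open>attach_loops (graph_complement G) S\<close>.\<close>

definition attach_loops :: "'a pair_pre_digraph \<Rightarrow> 'a set \<Rightarrow> 'a pair_pre_digraph" where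
  "attach_loops G S = \<lparr> pverts = pverts G, parcs = parcs G \<union> {(v, v) | v. v \<in> S} \<rparr>"

text \<open>Matrices are indexed by positions in a list \<open>vs\<close> enumerating the vertices.\<close>

definition adjacency_matrix :: "'a list \<Rightarrow> 'a pair_pre_digraph \<Rightarrow> real mat" where
  "adjacency_matrix vs G = mat (length vs) (length vs)
     (\<lambda>(i, j). if (vs ! i, vs ! j) \<in> parcs G then 1 else 0)"

definition loop_matrix :: "'a list \<Rightarrow> 'a set \<Rightarrow> real mat" where
  "loop_matrix vs S = mat (length vs) (length vs)
     (\<lambda>(i, j). if i = j \<and> vs ! i \<in> S then 1 else 0)"

definition selfloop_adjacency_matrix :: "'a list \<Rightarrow> 'a pair_pre_digraph \<Rightarrow> 'a set \<Rightarrow> real mat" where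
  "selfloop_adjacency_matrix vs G S = adjacency_matrix vs G + loop_matrix vs S"

text \<open>Meant for real symmetric matrices of positive dimension, whose real spectrum is
  finite and nonempty.\<close>

definition largest_eigenvalue :: "real mat \<Rightarrow> real" where
  "largest_eigenvalue A = Max (spectrum A)"

lemma pair_graph_graph_complement:
  assumes "pair_graph G"
  shows "pair_graph (graph_complement G)"
proof -
  interpret pair_graph G by fact
  have "parcs (graph_complement G) \<subseteq> pverts G \<times> pverts G"
    by (auto simp: graph_complement_def)
  then have fin: "finite (parcs (graph_complement G))"
    using pair_finite_verts finite_subset by blast
  have "(v, u) \<in> parcs G \<longleftrightarrow> (u, v) \<in> parcs G" for u v
    using pair_sym_arcs by (auto simp: symmetric_def sym_def)
  then show ?thesis
    using fin pair_finite_verts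
    by unfold_locales
       (auto simp: graph_complement_def symmetric_def sym_def arcs_ends_def arc_to_ends_def)
qed

lemma selfloop_adjacency_matrix_conv_attach_loops:
  assumes "pair_graph G" "distinct vs"
  shows "selfloop_adjacency_matrix vs G S = adjacency_matrix vs (attach_loops G S)"
proof -
  interpret pair_graph G by fact
  have "(v, v) \<notin> parcs G" for v
    using pair_no_loops by fastforce
  then show ?thesis
    using assms(2)
    by (intro eq_matI)
       (auto simp: selfloop_adjacency_matrix_def adjacency_matrix_def loop_matrix_def
         attach_loops_def nth_eq_iff_index_eq)
qed

end

theory Submission
  imports Defs "HOL-Analysis.Function_Topology" "HOL-Analysis.Convex"
begin

text \<open>
  The adjacency matrices of \<open>G\<^sub>S\<close> and of its complement add up to \<open>J - I + 2 I\<^sub>S\<close>. The lower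
  bound is the Rayleigh quotient of the all-ones vector for both matrices. For the upper bound,
  a real eigenvalue \<open>\<mu>\<close> of an \<open>n \<times> n\<close> matrix \<open>A\<close> with unit eigenvector \<open>x\<close> satisfies
  \<open>(\<mu> - tr A / n)\<^sup>2 \<le> (n - 1) / n * (\<parallel>A\<parallel>\<^sup>2 - (tr A)\<^sup>2 / n)\<close> in the Frobenius norm, by the
  Cauchy-Schwarz inequality for the inner product of \<open>A - (tr A / n) I\<close> and \<open>x x\<^sup>T - I / n\<close>.
  For the 0/1 matrices at hand \<open>\<parallel>A\<parallel>\<^sup>2\<close> is the sum of the entries, and \<open>p + q \<le> sqrt (2 (p\<^sup>2 + q\<^sup>2))\<close>
  combines the two estimates.
\<close>

section \<open>Variational description of the largest eigenvalue\<close>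

lemma quadratic_nonneg_imp_linear_coeff_zero:
  fixes b c :: real
  assumes "\<And>t. 0 \<le> t * b + t\<^sup>2 * c"
  shows "b = 0"
proof (rule ccontr)
  assume "b \<noteq> 0"
  \<comment> \<open>The summand 1 keeps \<open>d\<close> positive even if \<open>c = 0\<close>. At
    \<open>t = - b / d\<close> the linear term outweighs the quadratic one, leaving at most
    \<open>- (b / d)\<^sup>2\<close>.\<close>
  define d where "d = \<bar>c\<bar> + 1"
  then have "d > 0" and c: "\<bar>c\<bar> = d - 1"
    by auto
  define t where "t = - b / d"
  have "t * b + t\<^sup>2 * c \<le> t * b + t\<^sup>2 * \<bar>c\<bar>"
    by (intro add_left_mono mult_left_mono) auto
  also have "\<dots> = - (b / d)\<^sup>2"
    unfolding t_def c using \<open>d > 0\<close> by (simp add: field_simps power2_eq_square)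
  also have "\<dots> < 0"
    using \<open>b \<noteq> 0\<close> \<open>d > 0\<close> by simp
  finally show False
    using assms[of t] by simp
qed

text \<open>Compactness of the unit sphere over \<open>I\<close>. The index type may be infinite, so
  coordinates outside \<open>I\<close> are pinned to 0. The sphere then lies in a product of compact
  sets, which is compact by Tychonoff, and a continuous \<open>q\<close> attains its maximum on
  it.\<close>

lemma ex_maximizer_on_sphere:
  fixes q :: "('i \<Rightarrow> real) \<Rightarrow> real"
  assumes "finite I" "I \<noteq> {}" "continuous_on UNIV q"
  shows "\<exists>x. (\<Sum>i\<in>I. (x i)\<^sup>2) = 1 \<and> (\<forall>i. i \<notin> I \<longrightarrow> x i = 0) \<and>
    (\<forall>y. (\<Sum>i\<in>I. (y i)\<^sup>2) = 1 \<longrightarrow> (\<forall>i. i \<notin> I \<longrightarrow> y i = 0) \<longrightarrow> q y \<le> q x)"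
proof -
  define S where "S = {x :: 'i \<Rightarrow> real. (\<Sum>i\<in>I. (x i)\<^sup>2) = 1 \<and> (\<forall>i. i \<notin> I \<longrightarrow> x i = 0)}"
  define K where "K = PiE UNIV (\<lambda>i. if i \<in> I then {-1..1::real} else {0})"
  have "compactin (product_topology (\<lambda>_. euclidean) UNIV) K"
    unfolding K_def compactin_PiE by auto
  then have "compact K"
    by (simp add: euclidean_product_topology)
  have "continuous_on UNIV (\<lambda>x :: 'i \<Rightarrow> real. \<Sum>i\<in>I. (x i)\<^sup>2)"
    by (intro continuous_intros continuous_on_product_coordinates)
  then have "closed {x :: 'i \<Rightarrow> real. (\<Sum>i\<in>I. (x i)\<^sup>2) = 1}"
    by (intro closed_Collect_eq) (auto intro: continuous_intros)
  moreover have "S = K \<inter> {x. (\<Sum>i\<in>I. (x i)\<^sup>2) = 1}"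
  \<comment> \<open>Each squared coordinate is at most the whole sum 1, so the sphere fits in the
    box \<open>K\<close>.\<close>
  proof -
    have "x i \<in> {-1..1}" if "i \<in> I" "(\<Sum>i\<in>I. (x i)\<^sup>2) = 1" for x :: "'i \<Rightarrow> real" and i
    proof -
      have "(x i)\<^sup>2 \<le> (\<Sum>i\<in>I. (x i)\<^sup>2)"
        using assms(1) that(1) by (intro member_le_sum) auto
      then have "\<bar>x i\<bar> \<le> 1"
        using that(2) by (simp add: abs_square_le_1)
      then show ?thesis
        by auto
    qed
    then show ?thesis
      unfolding S_def K_def by (force simp: PiE_def Pi_def split: if_splits)
  qed
  ultimately have "compact S"
    using \<open>compact K\<close> by (simp add: compact_Int_closed)
  moreover have "S \<noteq> {}"
  proof -
    obtain k where "k \<in> I"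
      using assms(2) by blast
    then have "(\<lambda>i. if i = k then 1 else 0) \<in> S"
      using assms(1) by (auto simp: S_def if_distrib[of "\<lambda>x. x\<^sup>2"] cong: if_cong)
    then show ?thesis
      by blast
  qed
  ultimately have "\<exists>x\<in>S. \<forall>y\<in>S. q y \<le> q x"
    using assms(3) by (intro continuous_attains_sup) (auto intro: continuous_on_subset)
  then show ?thesis
    unfolding S_def by blast
qed

text \<open>A maximizer of the quadratic form on the unit sphere is an eigenvector: its first-order
  condition in each coordinate direction is one row of the eigenvalue equation, and \<mu> is the
  maximum itself.\<close>

lemma ex_eigenpair_dominating_Rayleigh_quotient:
  fixes a :: "'i \<Rightarrow> 'i \<Rightarrow> real"
  assumes fin: "finite I" and "I \<noteq> {}"
    and sym: "\<And>i j. i \<in> I \<Longrightarrow> j \<in> I \<Longrightarrow> a i j = a j i"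
  shows "\<exists>\<mu> x. (\<Sum>i\<in>I. (x i)\<^sup>2) = 1 \<and> (\<forall>i\<in>I. (\<Sum>j\<in>I. a i j * x j) = \<mu> * x i) \<and>
    (\<forall>y. (\<Sum>i\<in>I. \<Sum>j\<in>I. a i j * y i * y j) \<le> \<mu> * (\<Sum>i\<in>I. (y i)\<^sup>2))"
proof -
  define B where "B = (\<lambda>x y :: 'i \<Rightarrow> real. \<Sum>i\<in>I. \<Sum>j\<in>I. a i j * x i * y j)"
  have "continuous_on UNIV (\<lambda>x. B x x)"
    unfolding B_def by (intro continuous_intros continuous_on_product_coordinates)
  from ex_maximizer_on_sphere[OF fin \<open>I \<noteq> {}\<close> this]
  obtain x where x: "(\<Sum>i\<in>I. (x i)\<^sup>2) = 1"
    and max: "\<And>y. (\<Sum>i\<in>I. (y i)\<^sup>2) = 1 \<Longrightarrow> \<forall>i. i \<notin> I \<longrightarrow> y i = 0 \<Longrightarrow> B y y \<le> B x x"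
    by blast
  define \<mu> where "\<mu> = B x x"
  have Rayleigh: "B y y \<le> \<mu> * (\<Sum>i\<in>I. (y i)\<^sup>2)" for y
  proof (cases "(\<Sum>i\<in>I. (y i)\<^sup>2) = 0")
    case True
    then have "\<forall>i\<in>I. y i = 0"
      using fin by (simp add: sum_nonneg_eq_0_iff)
    then have "B y y = 0"
      by (simp add: B_def)
    then show ?thesis
      using True by simp
  next
    case False
    define r where "r = (\<Sum>i\<in>I. (y i)\<^sup>2)"
    have "r > 0"
      using False sum_nonneg[of I "\<lambda>i. (y i)\<^sup>2"] by (simp add: r_def)
    \<comment> \<open>The normalized \<open>y\<close>, cut off outside \<open>I\<close> to meet the
      constraint of the maximization. The form \<open>B\<close> only sees coordinates in
      \<open>I\<close>, so it merely scales by \<open>1 / r\<close>.\<close>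
    define z where "z = (\<lambda>i. if i \<in> I then y i / sqrt r else 0)"
    have "(\<Sum>i\<in>I. (z i)\<^sup>2) = (\<Sum>i\<in>I. (y i)\<^sup>2 / r)"
      using \<open>r > 0\<close> by (intro sum.cong) (auto simp: z_def power_divide)
    also have "\<dots> = 1"
      using \<open>r > 0\<close> by (simp add: sum_divide_distrib[symmetric] r_def[symmetric])
    finally have "B z z \<le> \<mu>"
      unfolding \<mu>_def by (rule max) (simp add: z_def)
    moreover have "B z z = (\<Sum>i\<in>I. \<Sum>j\<in>I. a i j * y i * y j / r)"
      unfolding B_def using \<open>r > 0\<close> by (intro sum.cong) (auto simp: z_def)
    then have "B z z = B y y / r"
      by (simp add: B_def sum_divide_distrib)
    ultimately show ?thesis
      using \<open>r > 0\<close> by (simp add: r_def[symmetric] field_simps)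
  qed
  have "(\<Sum>j\<in>I. a k j * x j) = \<mu> * x k" if k: "k \<in> I" for k
  proof -
    define e :: "'i \<Rightarrow> real" where "e = (\<lambda>i. if i = k then 1 else 0)"
    have e1: "B e x = (\<Sum>j\<in>I. a k j * x j)"
    proof -
      have "B e x = (\<Sum>i\<in>I. if i = k then \<Sum>j\<in>I. a i j * x j else 0)"
        unfolding B_def e_def by (intro sum.cong) auto
      then show ?thesis
        using fin k by simp
    qed
    have "B x e = (\<Sum>j\<in>I. \<Sum>i\<in>I. a i j * x i * e j)"
      unfolding B_def by (rule sum.swap)
    also have "\<dots> = B e x"
      unfolding B_def using sym by (intro sum.cong) auto
    finally have e2: "B x e = B e x" .
    \<comment> \<open>This is \<open>Rayleigh\<close> at the perturbation \<open>x + t * e\<close>.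
      The terms constant in \<open>t\<close> cancel because \<open>B x x = \<mu>\<close> and
      \<open>x\<close> has norm 1; symmetry merges the two mixed terms.\<close>
    have "0 \<le> t * (2 * (\<mu> * x k - B e x)) + t\<^sup>2 * (\<mu> - B e e)" for t
    proof -
      have "B (\<lambda>i. x i + t * e i) (\<lambda>i. x i + t * e i) =
        (\<Sum>i\<in>I. \<Sum>j\<in>I. a i j * x i * x j + t * (a i j * x i * e j) + t * (a i j * e i * x j)
          + t\<^sup>2 * (a i j * e i * e j))"
        unfolding B_def by (intro sum.cong refl) (simp add: power2_eq_square algebra_simps)
      also have "\<dots> = B x x + t * B x e + t * B e x + t\<^sup>2 * B e e"
        by (simp only: B_def sum.distrib sum_distrib_left)
      finally have "B (\<lambda>i. x i + t * e i) (\<lambda>i. x i + t * e i)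
        = B x x + t * B x e + t * B e x + t\<^sup>2 * B e e" .
      moreover have "(\<Sum>i\<in>I. (x i + t * e i)\<^sup>2)
        = (\<Sum>i\<in>I. (x i)\<^sup>2) + (\<Sum>i\<in>I. if i = k then 2 * t * x i + t\<^sup>2 else 0)"
        unfolding sum.distrib[symmetric] e_def by (intro sum.cong) (auto simp: power2_sum)
      then have "(\<Sum>i\<in>I. (x i + t * e i)\<^sup>2) = 1 + 2 * t * x k + t\<^sup>2"
        using fin k x by simp
      ultimately show ?thesis
        using Rayleigh[of "\<lambda>i. x i + t * e i"] e2 by (simp add: \<mu>_def[symmetric] algebra_simps)
    qed
    then have "2 * (\<mu> * x k - B e x) = 0"
      by (rule quadratic_nonneg_imp_linear_coeff_zero)
    then show ?thesis
      by (simp add: e1)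
  qed
  then show ?thesis
    using x Rayleigh unfolding B_def by blast
qed

section \<open>Distance of an eigenvalue from the mean of the diagonal\<close>

lemma eigenvalue_deviation_bound:
  fixes a :: "'i \<Rightarrow> 'i \<Rightarrow> real"
  assumes fin: "finite I"
    and eig: "\<And>i. i \<in> I \<Longrightarrow> (\<Sum>j\<in>I. a i j * x j) = \<mu> * x i"
    and nz: "k \<in> I" "x k \<noteq> 0"
  defines "n \<equiv> real (card I)" and "\<tau> \<equiv> \<Sum>i\<in>I. a i i"
  shows "(\<mu> - \<tau> / n)\<^sup>2 \<le> (n - 1) / n * ((\<Sum>i\<in>I. \<Sum>j\<in>I. (a i j)\<^sup>2) - \<tau>\<^sup>2 / n)"
proof -
  have n: "n > 0"
    using fin nz(1) by (auto simp: n_def card_gt_0_iff)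
  define r where "r = (\<Sum>i\<in>I. (x i)\<^sup>2)"
  have "(x k)\<^sup>2 \<le> r"
    unfolding r_def using fin nz(1) by (intro member_le_sum) auto
  then have r: "r > 0"
    using nz(2) by (smt (verit) zero_less_power2)
  define \<delta> :: "'i \<Rightarrow> 'i \<Rightarrow> real" where "\<delta> = (\<lambda>i j. if i = j then 1 else 0)"
  \<comment> \<open>The trace-free parts of the matrix and of the projection onto the line of
    \<open>x\<close>, as vectors indexed by \<open>I \<times> I\<close>. Dividing by
    \<open>r\<close> replaces normalizing \<open>x\<close>.\<close>
  define b where "b = (\<lambda>(i, j). a i j - \<tau> / n * \<delta> i j)"
  define c where "c = (\<lambda>(i, j). x i * x j / r - \<delta> i j / n)"
  \<comment> \<open>Collapses a double sum to the diagonal. The expansions below keep \<delta> as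
    the left factor so that this equation rewrites them.\<close>
  have \<delta>: "(\<Sum>i\<in>I. \<Sum>j\<in>I. \<delta> i j * f i j) = (\<Sum>i\<in>I. f i i)" for f
    using fin by (simp add: \<delta>_def if_distrib[of "\<lambda>x. x * _"] cong: if_cong)
  have axx: "(\<Sum>i\<in>I. \<Sum>j\<in>I. a i j * (x i * x j)) = \<mu> * r"
  proof -
    have "(\<Sum>i\<in>I. \<Sum>j\<in>I. a i j * (x i * x j)) = (\<Sum>i\<in>I. x i * (\<Sum>j\<in>I. a i j * x j))"
      by (simp add: sum_distrib_left mult_ac)
    also have "\<dots> = (\<Sum>i\<in>I. \<mu> * (x i)\<^sup>2)"
      using eig by (intro sum.cong) (auto simp: power2_eq_square)
    finally show ?thesis
      by (simp add: r_def sum_distrib_left)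
  qed
  have "(\<Sum>p\<in>I \<times> I. b p * c p) = (\<Sum>i\<in>I. \<Sum>j\<in>I. b (i, j) * c (i, j))"
    by (simp add: sum.cartesian_product)
  also have "\<dots> = (\<Sum>i\<in>I. \<Sum>j\<in>I. (1 / r) * (a i j * (x i * x j)) - \<delta> i j * (a i j / n)
      - \<delta> i j * (\<tau> / n / r * (x i * x j)) + \<delta> i j * (\<tau> / n / n))"
    by (intro sum.cong) (auto simp: b_def c_def \<delta>_def algebra_simps)
  also have "\<dots> = (1 / r) * (\<Sum>i\<in>I. \<Sum>j\<in>I. a i j * (x i * x j)) - (\<Sum>i\<in>I. a i i / n)
      - (\<Sum>i\<in>I. \<tau> / n / r * (x i * x i)) + (\<Sum>i\<in>I. \<tau> / n / n)"
    by (simp only: sum.distrib sum_subtractf \<delta> sum_distrib_left)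
  \<comment> \<open>The three corrections to \<mu> are \<open>\<tau> / n\<close> with signs minus,
    minus, plus.\<close>
  also have "\<dots> = \<mu> - \<tau> / n"
  proof -
    have "(\<Sum>i\<in>I. \<tau> / n / r * (x i * x i)) = \<tau> / n / r * r"
      unfolding r_def by (simp add: sum_distrib_left power2_eq_square)
    moreover have "(\<Sum>i\<in>I. \<tau> / n / n) = \<tau> / n"
      using n by (simp add: n_def)
    moreover have "(\<Sum>i\<in>I. a i i / n) = \<tau> / n"
      by (simp add: \<tau>_def sum_divide_distrib)
    ultimately show ?thesis
      using r by (simp add: axx)
  qed
  finally have bc: "(\<Sum>p\<in>I \<times> I. b p * c p) = \<mu> - \<tau> / n" .
  have "(\<Sum>p\<in>I \<times> I. (b p)\<^sup>2) = (\<Sum>i\<in>I. \<Sum>j\<in>I. (b (i, j))\<^sup>2)"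
    by (simp add: sum.cartesian_product)
  also have "\<dots> = (\<Sum>i\<in>I. \<Sum>j\<in>I. (a i j)\<^sup>2 - \<delta> i j * (2 * \<tau> / n * a i j) + \<delta> i j * (\<tau> / n)\<^sup>2)"
    by (intro sum.cong) (auto simp: b_def \<delta>_def power2_eq_square algebra_simps)
  also have "\<dots> = (\<Sum>i\<in>I. \<Sum>j\<in>I. (a i j)\<^sup>2) - (\<Sum>i\<in>I. 2 * \<tau> / n * a i i) + (\<Sum>i\<in>I. (\<tau> / n)\<^sup>2)"
    by (simp only: sum.distrib sum_subtractf \<delta>)
  also have "\<dots> = (\<Sum>i\<in>I. \<Sum>j\<in>I. (a i j)\<^sup>2) - 2 * \<tau> / n * \<tau> + n * (\<tau> / n)\<^sup>2"
    by (simp add: \<tau>_def n_def sum_distrib_left)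
  also have "\<dots> = (\<Sum>i\<in>I. \<Sum>j\<in>I. (a i j)\<^sup>2) - \<tau>\<^sup>2 / n"
    using n by (simp add: power2_eq_square field_simps)
  finally have bb: "(\<Sum>p\<in>I \<times> I. (b p)\<^sup>2) = (\<Sum>i\<in>I. \<Sum>j\<in>I. (a i j)\<^sup>2) - \<tau>\<^sup>2 / n" .
  have "(\<Sum>p\<in>I \<times> I. (c p)\<^sup>2) = (\<Sum>i\<in>I. \<Sum>j\<in>I. (c (i, j))\<^sup>2)"
    by (simp add: sum.cartesian_product)
  also have "\<dots> = (\<Sum>i\<in>I. \<Sum>j\<in>I. 1 / r\<^sup>2 * ((x i)\<^sup>2 * (x j)\<^sup>2) - \<delta> i j * (2 / n / r * (x i * x j))
      + \<delta> i j * (1 / n / n))"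
    by (intro sum.cong) (auto simp: c_def \<delta>_def power2_eq_square algebra_simps)
  also have "\<dots> = 1 / r\<^sup>2 * (\<Sum>i\<in>I. \<Sum>j\<in>I. (x i)\<^sup>2 * (x j)\<^sup>2) - (\<Sum>i\<in>I. 2 / n / r * (x i * x i))
      + (\<Sum>i\<in>I. 1 / n / n)"
    by (simp only: sum.distrib sum_subtractf \<delta> sum_distrib_left)
  \<comment> \<open>The three sums contribute \<open>1 - 2 / n + 1 / n\<close>.\<close>
  also have "\<dots> = (n - 1) / n"
  proof -
    have "(\<Sum>i\<in>I. \<Sum>j\<in>I. (x i)\<^sup>2 * (x j)\<^sup>2) = r\<^sup>2"
      by (simp add: r_def power2_eq_square[of "sum _ _"] sum_product)
    moreover have "(\<Sum>i\<in>I. 2 / n / r * (x i * x i)) = 2 / n / r * r"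
      unfolding r_def by (simp add: sum_distrib_left power2_eq_square)
    moreover have "(\<Sum>i\<in>I. 1 / n / n) = 1 / n"
      using n by (simp add: n_def)
    ultimately show ?thesis
      using n r by (simp add: field_simps)
  qed
  finally have cc: "(\<Sum>p\<in>I \<times> I. (c p)\<^sup>2) = (n - 1) / n" .
  have "(\<Sum>p\<in>I \<times> I. b p * c p)\<^sup>2 \<le> (\<Sum>p\<in>I \<times> I. (b p)\<^sup>2) * (\<Sum>p\<in>I \<times> I. (c p)\<^sup>2)"
    by (rule Cauchy_Schwarz_ineq_sum)
  then show ?thesis
    unfolding bb cc bc by (simp add: mult.commute)
qed

section \<open>Transfer to matrices and their spectra\<close>

lemma mult_mat_vec_nth_eq_sum:
  assumes "A \<in> carrier_mat n n" "v \<in> carrier_vec n" "i < n"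
  shows "(A *\<^sub>v v) $ i = (\<Sum>j\<in>{..<n}. A $$ (i, j) * v $ j)"
  using assms by (auto simp: scalar_prod_def atLeast0LessThan)

text \<open>The maximizing \<mu> shows that the real spectrum is nonempty; as it is also finite, its
  \<open>Max\<close> is an eigenvalue and at least \<mu>. Passing from \<mu> to \<open>Max\<close>
  preserves the Rayleigh bound, since a sum of squares is nonnegative.\<close>

lemma largest_eigenvalue_symmetric:
  fixes A :: "real mat"
  assumes A: "A \<in> carrier_mat n n" and n: "n > 0"
    and sym: "\<And>i j. i < n \<Longrightarrow> j < n \<Longrightarrow> A $$ (i, j) = A $$ (j, i)"
  shows "eigenvalue A (largest_eigenvalue A)"
    and "(\<Sum>i<n. \<Sum>j<n. A $$ (i, j) * y i * y j) \<le> largest_eigenvalue A * (\<Sum>i<n. (y i)\<^sup>2)"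
proof -
  have "\<exists>\<mu> x. (\<Sum>i<n. (x i)\<^sup>2) = 1 \<and> (\<forall>i\<in>{..<n}. (\<Sum>j<n. A $$ (i, j) * x j) = \<mu> * x i) \<and>
      (\<forall>y. (\<Sum>i<n. \<Sum>j<n. A $$ (i, j) * y i * y j) \<le> \<mu> * (\<Sum>i<n. (y i)\<^sup>2))"
    by (rule ex_eigenpair_dominating_Rayleigh_quotient) (use n sym in auto)
  then obtain \<mu> x where x: "(\<Sum>i<n. (x i)\<^sup>2) = 1"
    and eig: "\<And>i. i < n \<Longrightarrow> (\<Sum>j<n. A $$ (i, j) * x j) = \<mu> * x i"
    and Rayleigh: "\<And>y. (\<Sum>i<n. \<Sum>j<n. A $$ (i, j) * y i * y j) \<le> \<mu> * (\<Sum>i<n. (y i)\<^sup>2)"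
    by blast
  define v where "v = vec n x"
  have "v \<noteq> 0\<^sub>v n"
  proof
    assume "v = 0\<^sub>v n"
    then have "x i = 0" if "i < n" for i
      using that by (metis index_vec index_zero_vec(1) v_def)
    then show False
      using x by simp
  qed
  moreover have "A *\<^sub>v v = \<mu> \<cdot>\<^sub>v v"
    using A eig by (intro eq_vecI) (auto simp: v_def mult_mat_vec_nth_eq_sum simp del: index_mult_mat_vec)
  ultimately have "eigenvalue A \<mu>"
    using A unfolding eigenvalue_def eigenvector_def by (auto simp: v_def intro!: exI[of _ v])
  then have mem: "\<mu> \<in> spectrum A"
    by (simp add: spectrum_def)
  have fin: "finite (spectrum A)"
    by (rule card_finite_spectrum[OF A])
  show "eigenvalue A (largest_eigenvalue A)"
    using Max_in[OF fin] mem unfolding largest_eigenvalue_def spectrum_def by blast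
  have "\<mu> \<le> largest_eigenvalue A"
    unfolding largest_eigenvalue_def using fin mem by (rule Max_ge)
  then have "\<mu> * (\<Sum>i<n. (y i)\<^sup>2) \<le> largest_eigenvalue A * (\<Sum>i<n. (y i)\<^sup>2)"
    by (intro mult_right_mono sum_nonneg) auto
  then show "(\<Sum>i<n. \<Sum>j<n. A $$ (i, j) * y i * y j) \<le> largest_eigenvalue A * (\<Sum>i<n. (y i)\<^sup>2)"
    using Rayleigh[of y] by linarith
qed

lemma eigenvalue_deviation_bound_mat:
  fixes A :: "real mat"
  assumes A: "A \<in> carrier_mat n n" and "eigenvalue A \<mu>"
  defines "\<tau> \<equiv> \<Sum>i<n. A $$ (i, i)"
  shows "(\<mu> - \<tau> / real n)\<^sup>2 \<le> (real n - 1) / real n * ((\<Sum>i<n. \<Sum>j<n. (A $$ (i, j))\<^sup>2) - \<tau>\<^sup>2 / real n)"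
proof -
  obtain v where v: "v \<in> carrier_vec n" "v \<noteq> 0\<^sub>v n" "A *\<^sub>v v = \<mu> \<cdot>\<^sub>v v"
    using assms(2) A by (auto simp: eigenvalue_def eigenvector_def)
  obtain k where "k < n" "v $ k \<noteq> 0"
    using v(1,2) by (metis carrier_vecD eq_vecI index_zero_vec)
  moreover have "(\<Sum>j<n. A $$ (i, j) * v $ j) = \<mu> * v $ i" if "i < n" for i
    using mult_mat_vec_nth_eq_sum[OF A v(1) that] v that by simp
  ultimately show ?thesis
    using eigenvalue_deviation_bound[of "{..<n}" "\<lambda>i j. A $$ (i, j)" "\<lambda>i. v $ i" \<mu> k]
    by (simp add: \<tau>_def)
qed

lemma sum_le_sqrt_of_sum_squares:
  fixes p q s :: real
  assumes "p\<^sup>2 + q\<^sup>2 \<le> s"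
  shows "p + q \<le> sqrt 2 * sqrt s"
proof -
  \<comment> \<open>The squares of \<open>p + q\<close> and \<open>p - q\<close> add up to twice the
    sum of the squares of \<open>p\<close> and \<open>q\<close>.\<close>
  have "(p + q)\<^sup>2 \<le> 2 * s"
    using assms zero_le_power2[of "p - q"] by (simp add: power2_sum power2_diff)
  then have "p + q \<le> sqrt (2 * s)"
    by (rule real_le_rsqrt)
  then show ?thesis
    by (simp add: real_sqrt_mult)
qed

section \<open>Adjacency matrices of self-loop graphs\<close>

lemma card_nth_mem_eq_card:
  assumes "distinct vs" "S \<subseteq> set vs"
  shows "card {i. i < length vs \<and> vs ! i \<in> S} = card S"
proof -
  have "(!) vs ` {i. i < length vs \<and> vs ! i \<in> S} = S"
    using assms(2) by (force simp: in_set_conv_nth subset_iff)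
  moreover have "inj_on ((!) vs) {i. i < length vs \<and> vs ! i \<in> S}"
    using assms(1) by (auto simp: inj_on_def nth_eq_iff_index_eq)
  ultimately show ?thesis
    by (metis card_image)
qed

lemma selfloop_adjacency_matrix_carrier:
  "selfloop_adjacency_matrix vs G S \<in> carrier_mat (length vs) (length vs)"
  by (simp add: selfloop_adjacency_matrix_def adjacency_matrix_def loop_matrix_def)

lemma selfloop_adjacency_matrix_index:
  assumes "pair_graph G" "distinct vs" "i < length vs" "j < length vs"
  shows "selfloop_adjacency_matrix vs G S $$ (i, j) =
    (if i = j then if vs ! i \<in> S then 1 else 0 else if (vs ! i, vs ! j) \<in> parcs G then 1 else 0)"
proof -
  interpret pair_graph G by fact
  have "(v, v) \<notin> parcs G" for v
    using pair_no_loops by fastforce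
  then show ?thesis
    using assms(3,4)
    by (simp add: selfloop_adjacency_matrix_def adjacency_matrix_def loop_matrix_def)
qed

text \<open>The entry sum \<open>e\<close> serves twice: it is the quadratic form at the all-ones
  vector, whose squared norm is \<open>n\<close>, and, the entries being 0 or 1, it is the squared
  Frobenius norm. The trace counts the loops.\<close>

lemma largest_eigenvalue_selfloop_bounds:
  fixes G :: "'a pair_pre_digraph"
  assumes "pair_graph G" "S \<subseteq> set vs" "distinct vs" "vs \<noteq> []"
  defines "n \<equiv> real (length vs)" and "\<sigma> \<equiv> real (card S)"
    and "A \<equiv> selfloop_adjacency_matrix vs G S"
  defines "e \<equiv> \<Sum>i<length vs. \<Sum>j<length vs. A $$ (i, j)"
  shows "e \<le> n * largest_eigenvalue A"
    and "(largest_eigenvalue A - \<sigma> / n)\<^sup>2 \<le> (n - 1) / n * (e - \<sigma>\<^sup>2 / n)"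
proof -
  interpret pair_graph G by fact
  note index = selfloop_adjacency_matrix_index[OF assms(1,3), of _ _ S, folded A_def]
  have carrier: "A \<in> carrier_mat (length vs) (length vs)"
    unfolding A_def by (rule selfloop_adjacency_matrix_carrier)
  have "(v, u) \<in> parcs G \<longleftrightarrow> (u, v) \<in> parcs G" for u v
    using pair_sym_arcs by (auto simp: symmetric_def sym_def)
  then have sym: "A $$ (i, j) = A $$ (j, i)" if "i < length vs" "j < length vs" for i j
    using that by (auto simp: index)
  have pos: "length vs > 0"
    using assms(4) by simp
  show "e \<le> n * largest_eigenvalue A"
    using largest_eigenvalue_symmetric(2)[OF carrier pos sym, of "\<lambda>_. 1"]
    by (simp add: e_def n_def mult.commute)
  have "(\<Sum>i<length vs. A $$ (i, i)) = (\<Sum>i<length vs. if vs ! i \<in> S then 1 else 0)"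
    by (intro sum.cong) (auto simp: index)
  also have "\<dots> = \<sigma>"
    using card_nth_mem_eq_card[OF assms(3,2)] by (simp add: \<sigma>_def sum.If_cases Int_def)
  finally have "(\<Sum>i<length vs. A $$ (i, i)) = \<sigma>" .
  moreover have "(\<Sum>i<length vs. \<Sum>j<length vs. (A $$ (i, j))\<^sup>2) = e"
    unfolding e_def by (intro sum.cong) (auto simp: index)
  ultimately show "(largest_eigenvalue A - \<sigma> / n)\<^sup>2 \<le> (n - 1) / n * (e - \<sigma>\<^sup>2 / n)"
    using eigenvalue_deviation_bound_mat[OF carrier largest_eigenvalue_symmetric(1)[OF carrier pos sym]]
    by (simp add: n_def)
qed

lemma sum_selfloop_adjacency_matrix_complement:
  fixes G :: "'a pair_pre_digraph"
  assumes "pair_graph G" "S \<subseteq> set vs" "distinct vs" "set vs = pverts G"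
  defines "n \<equiv> real (length vs)" and "A \<equiv> \<lambda>H. selfloop_adjacency_matrix vs H S"
  shows "(\<Sum>i<length vs. \<Sum>j<length vs. A G $$ (i, j))
    + (\<Sum>i<length vs. \<Sum>j<length vs. A (graph_complement G) $$ (i, j)) = n * (n - 1) + 2 * real (card S)"
proof -
  note index = selfloop_adjacency_matrix_index[OF assms(1,3)]
    selfloop_adjacency_matrix_index[OF pair_graph_graph_complement[OF assms(1)] assms(3)]
  have inner: "(\<Sum>j<length vs. A G $$ (i, j) + A (graph_complement G) $$ (i, j))
    = n - 1 + (if vs ! i \<in> S then 2 else 0)" if i: "i < length vs" for i
  proof -
    have "(\<Sum>j<length vs. A G $$ (i, j) + A (graph_complement G) $$ (i, j))
      = (\<Sum>j<length vs. 1 + (if i = j then (if vs ! i \<in> S then 2 else 0) - 1 else 0))"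
    proof (intro sum.cong refl)
      fix j
      assume "j \<in> {..<length vs}"
      then have j: "j < length vs"
        by simp
      then have "vs ! i \<in> pverts G" "vs ! j \<in> pverts G"
        using i nth_mem unfolding assms(4)[symmetric] by blast+
      moreover have "vs ! i = vs ! j \<longleftrightarrow> i = j"
        using assms(3) i j by (simp add: nth_eq_iff_index_eq)
      ultimately show "A G $$ (i, j) + A (graph_complement G) $$ (i, j)
        = 1 + (if i = j then (if vs ! i \<in> S then 2 else 0) - 1 else 0)"
        using i j by (simp add: A_def index) (simp add: graph_complement_def)
    qed
    also have "\<dots> = n - 1 + (if vs ! i \<in> S then 2 else 0)"
      using i by (simp add: sum.distrib n_def)
    finally show ?thesis .
  qed
  have "(\<Sum>i<length vs. \<Sum>j<length vs. A G $$ (i, j))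
    + (\<Sum>i<length vs. \<Sum>j<length vs. A (graph_complement G) $$ (i, j))
    = (\<Sum>i<length vs. n - 1 + (if vs ! i \<in> S then 2 else 0))"
    unfolding sum.distrib[symmetric] using inner by (intro sum.cong) auto
  also have "\<dots> = n * (n - 1) + 2 * real (card {i. i < length vs \<and> vs ! i \<in> S})"
    by (simp add: sum.distrib n_def sum.If_cases Int_def)
  finally show ?thesis
    by (simp add: card_nth_mem_eq_card[OF assms(3,2)])
qed

theorem theorem4p4:
  fixes G :: "'a pair_pre_digraph" and S :: "'a set" and vs :: "'a list"
    and n m mbar \<sigma> :: nat and ev1 ev1bar :: real
  assumes "pair_graph G" and "S \<subseteq> pverts G"
    and "n = card (pverts G)" and "n \<ge> 2"
    and "m = graph_size G" and "m \<ge> 1"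
    and "\<sigma> = card S"
    and "mbar = graph_size (graph_complement G)"
    and "Digraph_Component.connected (with_proj (attach_loops G S))"
    and "Digraph_Component.connected (with_proj (attach_loops (graph_complement G) S))"
    and "distinct vs" and "set vs = pverts G"
    and "ev1 = largest_eigenvalue (selfloop_adjacency_matrix vs G S)"
    and "ev1bar = largest_eigenvalue (selfloop_adjacency_matrix vs (graph_complement G) S)"
  shows "real n - 1 + 2 * real \<sigma> / real n \<le> ev1 + ev1bar
    \<and> ev1 + ev1bar \<le> 2 * real \<sigma> / real n
        + sqrt 2 * sqrt (2 * real \<sigma> * (real n - 1) * (real n - real \<sigma>) / (real n)\<^sup>2
                         + (real n - 1)\<^sup>2)"
proof -
  define N where "N = real n"
  define s where "s = real \<sigma>"
  define A where "A = selfloop_adjacency_matrix vs G S"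
  define A' where "A' = selfloop_adjacency_matrix vs (graph_complement G) S"
  define e where "e = (\<Sum>i<length vs. \<Sum>j<length vs. A $$ (i, j))"
  define e' where "e' = (\<Sum>i<length vs. \<Sum>j<length vs. A' $$ (i, j))"
  have len: "length vs = n"
    using assms(3,11,12) distinct_card[of vs] by simp
  have S: "S \<subseteq> set vs" and ne: "vs \<noteq> []"
    using assms(2,4,12) len by auto
  have N: "N \<ge> 2"
    using assms(4) by (simp add: N_def)
  note bounds = largest_eigenvalue_selfloop_bounds[OF assms(1) S assms(11) ne,
      folded A_def, folded e_def, unfolded len, folded N_def assms(7) s_def]
    and bounds' = largest_eigenvalue_selfloop_bounds[OF pair_graph_graph_complement[OF assms(1)] S
      assms(11) ne, folded A'_def, folded e'_def, unfolded len, folded N_def assms(7) s_def]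
  have ev: "largest_eigenvalue A = ev1" "largest_eigenvalue A' = ev1bar"
    using assms(13,14) by (auto simp: A_def A'_def)
  have ee: "e + e' = N * (N - 1) + 2 * s"
    using sum_selfloop_adjacency_matrix_complement[OF assms(1) S assms(11,12)]
    by (simp add: A_def A'_def e_def e'_def len N_def s_def assms(7))
  \<comment> \<open>Only the total \<open>e + e'\<close> is known in terms of \<open>N\<close> and
    \<open>s\<close>, so the bounds for the two graphs are added before it is substituted.\<close>
  have "N * (N - 1) + 2 * s \<le> N * (ev1 + ev1bar)"
    using bounds(1) bounds'(1) ee by (simp add: ev distrib_left)
  then have lower: "N - 1 + 2 * s / N \<le> ev1 + ev1bar"
    using N by (simp add: field_simps)
  \<comment> \<open>Both matrices have trace \<open>s\<close>, hence the same center
    \<open>s / N\<close> and the same factor, and the two right-hand sides again combine to a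
    function of \<open>e + e'\<close>. Moving both centers across at the end gives the summand
    \<open>2 * s / N\<close>.\<close>
  have "(ev1 - s / N)\<^sup>2 + (ev1bar - s / N)\<^sup>2 \<le> (N - 1) / N * ((e + e') - 2 * s\<^sup>2 / N)"
    using bounds(2) bounds'(2) by (simp add: ev algebra_simps add_divide_distrib diff_divide_distrib)
  also have "\<dots> = 2 * s * (N - 1) * (N - s) / N\<^sup>2 + (N - 1)\<^sup>2"
    unfolding ee using N by (simp add: field_simps power2_eq_square)
  finally have "(ev1 - s / N) + (ev1bar - s / N)
    \<le> sqrt 2 * sqrt (2 * s * (N - 1) * (N - s) / N\<^sup>2 + (N - 1)\<^sup>2)"
    by (rule sum_le_sqrt_of_sum_squares)
  then show ?thesis
    using lower unfolding N_def s_def by simp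
qed

end
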